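(* Let $E$ be a real uniformly smooth and uniformly convex Banach space and let $C$ be a nonempty closed convex subset of $E$. Let $T_1,\dots,T_N : C\to C$ be a finite family of asymptotically quasi $\phi$-nonexpansive mappings with a common sequence $\{k_n\}_{n\ge 0}\subset[1,+\infty)$, $k_n\to 1$. Suppose that for each $i=1,\dots,N$ the mapping $T_i$ is uniformly $L_i$-Lipschitz continuous for some $L_i>0$, and that the set $F=\bigcap_{i=1}^N F(T_i)$ is nonempty and bounded in $C$, i.e. there is a positive number $\omega$ such that $F\subset\Omega:=\{u\in C:\|u\|\le\omega\}$. Let $\{\alpha_n\}_{n\ge 0}$ be a sequence in $[0,1]$ with $\lim_{n\to\infty}\alpha_n=0$. Let $\{x_n\}$ be the sequence generated by $x_0\in C$, $C_0:=C$, and, for $n\ge 0$, $$y_n^i=J^{-1}\left(\alpha_n Jx_n+(1-\alpha_n)JT_i^n x_n\right),\quad i=1,\dots,N,$$ $$i_n\in\arg\max_{1\le i\le N}\|y_n^i-x_n\|,\qquad \bar y_n:=y_n^{i_n},$$ $$C_{n+1}:=\{v\in C_n:\phi(v,\bar y_n)\le\phi(v,x_n)+\epsilon_n\},$$ $$x_{n+1}=\Pi_{C_{n+1}}x_0,$$ where $\epsilon_n:=(k_n-1)(\omega+\|x_n\|)^2$. Then $\{x_n\}$ converges strongly to $x^\dagger:=\Pi_F x_0$.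
   Context: Let $E$ be a smooth, strictly convex, reflexive real Banach space with dual $E^*$. $J:E\to E^*$ is the normalized duality mapping: $J(x)$ is the unique $f\in E^*$ with $\langle f,x\rangle=\|x\|^2=\|f\|^2$; it is a bijection. The Lyapunov functional is $\phi(x,y)=\|x\|^2-2\langle x,Jy\rangle+\|y\|^2$ for $x,y\in E$. For a nonempty closed convex $K\subset E$, the generalized projection $\Pi_K:E\to K$ is $\Pi_K(x)=\arg\min_{y\in K}\phi(y,x)$. For $T:C\to C$, $F(T)$ is the set of fixed points of $T$, $T^n$ is the $n$-th iterate and $T^0$ is the identity. $T$ is asymptotically quasi $\phi$-nonexpansive with sequence $\{k_n\}\subset[1,+\infty)$, $k_n\to1$, if $F(T)\neq\emptyset$ and $\phi(p,T^nx)\le k_n\phi(p,x)$ for all $n\ge1$, $p\in F(T)$, $x\in C$. $T$ is uniformly $L$-Lipschitz continuous ($L>0$) if $\|T^nx-T^ny\|\le L\|x-y\|$ for all $n\ge1$ and $x,y\in C$. *)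

theory Defs
  imports "HOL-Analysis.Analysis"
begin

definition uniformly_convex_space :: "'a::real_normed_vector itself \<Rightarrow> bool" where
  "uniformly_convex_space _ \<longleftrightarrow>
    (\<forall>\<epsilon>>0. \<exists>\<delta>>0. \<forall>x y :: 'a. norm x \<le> 1 \<longrightarrow> norm y \<le> 1 \<longrightarrow> norm (x - y) \<ge> \<epsilon> \<longrightarrow>
      norm ((1 / 2) *\<^sub>R (x + y)) \<le> 1 - \<delta>)"

definition uniformly_smooth_space :: "'a::real_normed_vector itself \<Rightarrow> bool" where
  "uniformly_smooth_space _ \<longleftrightarrow>
    (\<exists>D. uniform_limit (sphere (0::'a) 1 \<times> sphere (0::'a) 1)
      (\<lambda>t (x, y). (norm (x + t *\<^sub>R y) - norm x) / t) D (at (0::real)))"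

(* Well defined on smooth spaces, where the functional described below is unique. *)
definition duality_map :: "'a::real_normed_vector \<Rightarrow> ('a \<Rightarrow>\<^sub>L real)" where
  "duality_map x =
    (THE f. blinfun_apply f x = (norm x)\<^sup>2 \<and> (norm x)\<^sup>2 = (norm f)\<^sup>2)"

definition lyapunov :: "'a::real_normed_vector \<Rightarrow> 'a \<Rightarrow> real" where
  "lyapunov x y = (norm x)\<^sup>2 - 2 * blinfun_apply (duality_map y) x + (norm y)\<^sup>2"

(* The minimizer exists and is unique when K is nonempty, closed and convex and the space is
   smooth, strictly convex and reflexive; otherwise the value may be arbitrary. *)
definition gen_proj :: "'a::real_normed_vector set \<Rightarrow> 'a \<Rightarrow> 'a" where
  "gen_proj K x = arg_min_on (\<lambda>y. lyapunov y x) K"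

definition fixed_points_on :: "'a set \<Rightarrow> ('a \<Rightarrow> 'a) \<Rightarrow> 'a set" where
  "fixed_points_on C T = {p \<in> C. T p = p}"

definition asymp_quasi_phi_nonexpansive ::
    "'a::real_normed_vector set \<Rightarrow> ('a \<Rightarrow> 'a) \<Rightarrow> (nat \<Rightarrow> real) \<Rightarrow> bool" where
  "asymp_quasi_phi_nonexpansive C T k \<longleftrightarrow>
    (\<forall>n. 1 \<le> k n) \<and> k \<longlonglongrightarrow> 1 \<and> fixed_points_on C T \<noteq> {} \<and>
    (\<forall>n\<ge>1. \<forall>p\<in>fixed_points_on C T. \<forall>x\<in>C. lyapunov p ((T ^^ n) x) \<le> k n * lyapunov p x)"

definition uniformly_lipschitz_on ::
    "real \<Rightarrow> 'a::real_normed_vector set \<Rightarrow> ('a \<Rightarrow> 'a) \<Rightarrow> bool" where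
  "uniformly_lipschitz_on L C T \<longleftrightarrow>
    0 < L \<and> (\<forall>n\<ge>1. \<forall>x\<in>C. \<forall>y\<in>C. norm ((T ^^ n) x - (T ^^ n) y) \<le> L * norm (x - y))"

end

theory Submission imports Defs begin

text \<open>
  For fixed \<open>x\<close>, minimizing \<open>\<lambda>v. lyapunov v x\<close> means minimizing \<open>(norm v)\<^sup>2 - 2 * f v\<close> for a functional
  \<open>f\<close>, and uniform convexity makes midpoints of distant points strictly better by a uniform amount.
  This gives the projections, surjectivity of the duality map (minimize over the whole space) and,
  as the \<open>Cs n\<close> decrease, strong convergence of the \<open>x n\<close> to some \<open>p\<close>. Since \<open>lyapunov u v\<close> dominates
  the midpoint defect of the squared norm at \<open>u\<close>, \<open>v\<close>, membership of \<open>x (Suc n)\<close> in \<open>Cs (Suc n)\<close>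
  forces \<open>ybar n\<close>, hence every \<open>y n j\<close>, and then \<open>(T j ^^ n) (x n)\<close>, to converge to \<open>p\<close>. The Lipschitz
  bounds give \<open>T j p = p\<close>, and \<open>p\<close> minimizes over all of \<open>\<Inter>n. Cs n\<close>, which contains \<open>F\<close>.
\<close>

section \<open>Consequences of uniform convexity\<close>

text \<open>If the norms differ by at least \<open>h\<close>, convexity of the square alone gains
  \<open>h\<^sup>2 / 4\<close>. Otherwise division by the larger norm \<open>b\<close> moves both
  vectors into the unit ball, where uniform convexity applies with separation
  \<open>e / R\<close>.\<close>

lemma uniformly_convex_midpoint_power2:
  fixes R e :: real
  assumes uc: "uniformly_convex_space TYPE('a::real_normed_vector)" and "R > 0" "e > 0"
  obtains d where "d > 0"
    "\<And>u v :: 'a. norm u \<le> R \<Longrightarrow> norm v \<le> R \<Longrightarrow> norm (u - v) \<ge> e \<Longrightarrow>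
      (norm ((1/2) *\<^sub>R (u + v)))\<^sup>2 \<le> ((norm u)\<^sup>2 + (norm v)\<^sup>2) / 2 - d"
proof -
  have "e / R > 0" using assms by simp
  then obtain c where c: "c > 0" and
    mid: "\<And>x y :: 'a. norm x \<le> 1 \<Longrightarrow> norm y \<le> 1 \<Longrightarrow> norm (x - y) \<ge> e / R \<Longrightarrow>
      norm ((1 / 2) *\<^sub>R (x + y)) \<le> 1 - c"
    using uc unfolding uniformly_convex_space_def by blast
  \<comment> \<open>Since \<open>b \<ge> e / 2\<close>, this \<open>h\<close> keeps the loss
    \<open>b * h\<close> caused by unequal norms below half of the gain
    \<open>b\<^sup>2 * c\<close>, so at least \<open>e\<^sup>2 * c / 8\<close> remains.\<close>
  define h where "h = e * c / 4"
  have h: "h > 0" using c \<open>e > 0\<close> by (simp add: h_def)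
  define d where "d = min (h\<^sup>2 / 4) (e\<^sup>2 * c / 8)"
  have d: "d > 0" "d \<le> h\<^sup>2 / 4" "d \<le> e\<^sup>2 * c / 8"
    using h c \<open>e > 0\<close> by (auto simp: d_def)
  have ordered: "(norm ((1/2) *\<^sub>R (u + v)))\<^sup>2 \<le> ((norm u)\<^sup>2 + (norm v)\<^sup>2) / 2 - d"
    if uv: "norm u \<le> norm v" "norm v \<le> R" "norm (u - v) \<ge> e" for u v :: 'a
  proof -
    define a b w where "a = norm u" and "b = norm v" and "w = norm ((1/2) *\<^sub>R (u + v))"
    have ab: "0 \<le> a" "a \<le> b" "b \<le> R" "0 \<le> w" using uv by (simp_all add: a_def b_def w_def)
    have "norm (u - v) \<le> a + b" unfolding a_def b_def by (rule norm_triangle_ineq4)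
    then have be: "e / 2 \<le> b" using ab uv by linarith
    then have b0: "b > 0" using \<open>e > 0\<close> by linarith
    have "w\<^sup>2 \<le> (a\<^sup>2 + b\<^sup>2) / 2 - d"
    proof (cases "b - a \<ge> h")
      case True
      have "norm (u + v) \<le> a + b" unfolding a_def b_def by (rule norm_triangle_ineq)
      then have "w \<le> (a + b) / 2" by (simp add: w_def)
      then have "w\<^sup>2 \<le> ((a + b) / 2)\<^sup>2" using ab by (intro power_mono) auto
      also have "\<dots> = (a\<^sup>2 + b\<^sup>2) / 2 - (b - a)\<^sup>2 / 4"
        by (simp add: power2_eq_square field_simps)
      also have "\<dots> \<le> (a\<^sup>2 + b\<^sup>2) / 2 - h\<^sup>2 / 4"
        using True h power_mono[of h "b - a" 2] by simp
      finally show ?thesis using d by linarith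
    next
      case False
      have n1: "norm ((1/b) *\<^sub>R u) \<le> 1" "norm ((1/b) *\<^sub>R v) \<le> 1"
        using ab b0 by (simp_all add: a_def b_def)
      have "norm ((1/b) *\<^sub>R u - (1/b) *\<^sub>R v) = norm (u - v) / b"
        using b0 by (simp flip: scaleR_diff_right)
      also have "\<dots> \<ge> e / R"
        using uv ab b0 \<open>e > 0\<close> by (intro frac_le) auto
      finally have "norm ((1 / 2) *\<^sub>R ((1/b) *\<^sub>R u + (1/b) *\<^sub>R v)) \<le> 1 - c"
        using mid[OF n1] by blast
      moreover have "(1 / 2) *\<^sub>R ((1/b) *\<^sub>R u + (1/b) *\<^sub>R v) = (1/b) *\<^sub>R ((1/2) *\<^sub>R (u + v))"
        by (simp add: scaleR_add_right mult.commute)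
      ultimately have "w / b \<le> 1 - c" using b0 by (simp add: w_def)
      then have wb: "w \<le> b * (1 - c)" and c1: "0 \<le> 1 - c"
        using b0 ab(4) divide_nonneg_pos[of w b] by (simp add: pos_divide_le_eq mult.commute, linarith)
      have "w\<^sup>2 \<le> (b * (1 - c))\<^sup>2" using wb ab by (intro power_mono)
      also have "\<dots> \<le> b\<^sup>2 * (1 - c)"
        using c1 c unfolding power_mult_distrib
        by (intro mult_left_mono) (auto simp: power2_eq_square mult_left_le)
      finally have 1: "w\<^sup>2 \<le> b\<^sup>2 * (1 - c)" .
      have "b * (b - a) \<le> b * h" using False b0 by (intro mult_left_mono) auto
      moreover have "b\<^sup>2 - b * (b - a) \<le> (a\<^sup>2 + b\<^sup>2) / 2"
        using zero_le_power2[of "b - a"] by (simp add: power2_eq_square field_simps)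
      moreover have "e * c / 4 \<le> b * c - h"
        using be c mult_right_mono[of "e/2" b c] by (simp add: h_def field_simps)
      then have "e / 2 * (e * c / 4) \<le> b * (b * c - h)"
        using be b0 c \<open>e > 0\<close> by (intro mult_mono) auto
      then have "e\<^sup>2 * c / 8 \<le> b\<^sup>2 * c - b * h"
        by (simp add: power2_eq_square algebra_simps)
      ultimately show ?thesis using 1 d(3) by (simp add: algebra_simps)
    qed
    then show ?thesis by (simp add: a_def b_def w_def)
  qed
  show ?thesis
  proof (rule that[OF \<open>d > 0\<close>])
    fix u v :: 'a
    assume "norm u \<le> R" "norm v \<le> R" "norm (u - v) \<ge> e"
    then show "(norm ((1/2) *\<^sub>R (u + v)))\<^sup>2 \<le> ((norm u)\<^sup>2 + (norm v)\<^sup>2) / 2 - d"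
      using ordered[of u v] ordered[of v u]
      by (cases "norm u \<le> norm v") (simp_all add: add.commute norm_minus_commute)
  qed
qed

lemma tendsto_diff_0_uniformly_convex:
  fixes u v :: "nat \<Rightarrow> 'a::real_normed_vector"
  assumes uc: "uniformly_convex_space TYPE('a)"
    and bu: "\<And>n. norm (u n) \<le> R" and bv: "\<And>n. norm (v n) \<le> R"
    and defect: "(\<lambda>n. ((norm (u n))\<^sup>2 + (norm (v n))\<^sup>2) / 2 - (norm ((1/2) *\<^sub>R (u n + v n)))\<^sup>2) \<longlonglongrightarrow> 0"
  shows "(\<lambda>n. u n - v n) \<longlonglongrightarrow> 0"
proof (rule LIMSEQ_I)
  fix e :: real assume "e > 0"
  have "max R 1 > 0" by simp
  from uniformly_convex_midpoint_power2[OF uc this \<open>e > 0\<close>] obtain d where d: "d > 0" and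
    D: "\<And>u v :: 'a. norm u \<le> max R 1 \<Longrightarrow> norm v \<le> max R 1 \<Longrightarrow> norm (u - v) \<ge> e \<Longrightarrow>
      (norm ((1/2) *\<^sub>R (u + v)))\<^sup>2 \<le> ((norm u)\<^sup>2 + (norm v)\<^sup>2) / 2 - d" by metis
  obtain M where M: "\<And>n. n \<ge> M \<Longrightarrow>
      ((norm (u n))\<^sup>2 + (norm (v n))\<^sup>2) / 2 - (norm ((1/2) *\<^sub>R (u n + v n)))\<^sup>2 < d"
    using order_tendstoD(2)[OF defect d] unfolding eventually_sequentially by blast
  have "norm (u n - v n - 0) < e" if "n \<ge> M" for n
  proof (rule ccontr)
    assume "\<not> norm (u n - v n - 0) < e"
    then show False using D[of "u n" "v n"] M[OF that] bu[of n] bv[of n] by simp linarith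
  qed
  then show "\<exists>M. \<forall>n\<ge>M. norm (u n - v n - 0) < e" by blast
qed

text \<open>Coercivity: beyond the bound, \<open>norm u\<close> and
  \<open>norm u - 2 * norm f\<close> both exceed \<open>sqrt c\<close>, while their product is at
  most \<open>(norm u)\<^sup>2 - 2 * f u\<close>.\<close>

lemma norm_le_of_quadratic_le:
  fixes f :: "'a::real_normed_vector \<Rightarrow>\<^sub>L real"
  assumes "(norm u)\<^sup>2 - 2 * f u \<le> c" and "0 \<le> c"
  shows "norm u \<le> 2 * norm f + sqrt c"
proof (rule ccontr)
  assume "\<not> ?thesis"
  then have *: "norm u > 2 * norm f + sqrt c" by simp
  have "norm f \<ge> 0" "sqrt c \<ge> 0" using assms by simp_all
  with * have pos: "sqrt c < norm u" "sqrt c < norm u - 2 * norm f" "0 < norm u" by linarith+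
  have "f u \<le> norm f * norm u" using norm_blinfun[of f u] by simp
  then have "norm u * (norm u - 2 * norm f) \<le> c"
    using assms by (simp add: power2_eq_square algebra_simps)
  moreover have "sqrt c * sqrt c < norm u * (norm u - 2 * norm f)"
    using pos assms by (intro mult_strict_mono) auto
  ultimately show False using assms by simp
qed

text \<open>With \<open>a\<close> constant this gives minimizers on one convex set; with \<open>a n\<close> the value at \<open>z n\<close>
  it gives convergence of minimizers along a decreasing sequence of convex sets.\<close>

lemma Cauchy_of_midpoint_lower_bound:
  fixes f :: "'a::real_normed_vector \<Rightarrow>\<^sub>L real" and z :: "nat \<Rightarrow> 'a"
  defines "q \<equiv> \<lambda>u. (norm u)\<^sup>2 - 2 * f u"
  assumes uc: "uniformly_convex_space TYPE('a)"
    and lim: "(\<lambda>n. q (z n)) \<longlonglongrightarrow> d" and a: "a \<longlonglongrightarrow> d"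
    and mid: "\<And>m n. n \<le> m \<Longrightarrow> a n \<le> q ((1/2) *\<^sub>R (z n + z m))"
  shows "Cauchy z"
proof (rule CauchyI')
  fix e :: real assume "e > 0"
  obtain B where B: "\<And>n. norm (q (z n)) \<le> B"
    using Bseq_def convergent_imp_Bseq[of "\<lambda>n. q (z n)"] lim convergentI by metis
  have "B \<ge> 0" using B[of 0] by (meson norm_ge_zero order_trans)
  define R where "R = 2 * norm f + sqrt B + 1"
  have zR: "norm (z n) \<le> R" for n
  proof -
    have "q (z n) \<le> B" using B[of n] by simp
    then have "norm (z n) \<le> 2 * norm f + sqrt B"
      using \<open>B \<ge> 0\<close> unfolding q_def by (rule norm_le_of_quadratic_le)
    then show ?thesis by (simp add: R_def)
  qed
  have "R > 0" using \<open>B \<ge> 0\<close> by (simp add: R_def add_nonneg_pos)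
  from uniformly_convex_midpoint_power2[OF uc this \<open>e > 0\<close>] obtain c where c: "c > 0" and
    D: "\<And>u v :: 'a. norm u \<le> R \<Longrightarrow> norm v \<le> R \<Longrightarrow> norm (u - v) \<ge> e \<Longrightarrow>
      (norm ((1/2) *\<^sub>R (u + v)))\<^sup>2 \<le> ((norm u)\<^sup>2 + (norm v)\<^sup>2) / 2 - c" by metis
  \<comment> \<open>A midpoint of distant terms has value below
    \<open>d + c / 2 - c = d - c / 2\<close>, which is below its own lower bound
    \<open>a n\<close>.\<close>
  have "\<forall>\<^sub>F n in sequentially. q (z n) < d + c / 2" "\<forall>\<^sub>F n in sequentially. a n > d - c / 2"
    using order_tendstoD(2)[OF lim, of "d + c/2"] order_tendstoD(1)[OF a, of "d - c/2"] c by auto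
  then have "\<forall>\<^sub>F n in sequentially. q (z n) < d + c / 2 \<and> a n > d - c / 2"
    by (rule eventually_conj)
  then obtain M where M: "\<And>n. n \<ge> M \<Longrightarrow> q (z n) < d + c / 2 \<and> a n > d - c / 2"
    unfolding eventually_sequentially by blast
  have "dist (z n) (z m) < e" if "n \<ge> M" "m > n" for m n
  proof (rule ccontr)
    assume "\<not> dist (z n) (z m) < e"
    then have "(norm ((1/2) *\<^sub>R (z n + z m)))\<^sup>2 \<le> ((norm (z n))\<^sup>2 + (norm (z m))\<^sup>2) / 2 - c"
      using D[OF zR zR] by (simp add: dist_norm)
    then have "q ((1/2) *\<^sub>R (z n + z m)) \<le> (q (z n) + q (z m)) / 2 - c"
      by (simp add: q_def blinfun.bilinear_simps field_simps)
    moreover have "a n \<le> q ((1/2) *\<^sub>R (z n + z m))" using mid that by simp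
    moreover have "q (z n) < d + c / 2" "q (z m) < d + c / 2" "d - c / 2 < a n"
      using M[of n] M[of m] that by auto
    ultimately show False by argo
  qed
  then show "\<exists>M. \<forall>m\<ge>M. \<forall>n>m. dist (z m) (z n) < e" by blast
qed

section \<open>Minimizers of a perturbed squared norm over convex sets\<close>

lemma midpoint_in_convex:
  assumes "convex S" "u \<in> S" "v \<in> S"
  shows "(1/2) *\<^sub>R (u + v) \<in> S"
  using convexD[OF assms, of "1/2" "1/2"] by (simp add: scaleR_add_right)

text \<open>Midpoints of a minimizing sequence stay in \<open>K\<close>, hence have value at least
  the infimum; this makes the sequence Cauchy, and its limit attains the infimum.\<close>

lemma exists_quadratic_minimizer:
  fixes f :: "'a::banach \<Rightarrow>\<^sub>L real" and K :: "'a set"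
  defines "q \<equiv> \<lambda>u. (norm u)\<^sup>2 - 2 * f u"
  assumes uc: "uniformly_convex_space TYPE('a)"
    and K: "K \<noteq> {}" "closed K" "convex K"
  obtains u where "u \<in> K" "\<And>v. v \<in> K \<Longrightarrow> q u \<le> q v"
proof -
  have lower: "q u \<ge> - (norm f)\<^sup>2" for u
  proof -
    have "f u \<le> norm f * norm u" using norm_blinfun[of f u] by simp
    then show ?thesis using zero_le_power2[of "norm u - norm f"]
      unfolding q_def by (simp add: power2_diff algebra_simps)
  qed
  then have bdd: "bdd_below (q ` K)" by (rule bdd_belowI2)
  define d where "d = Inf (q ` K)"
  have dle: "d \<le> q v" if "v \<in> K" for v
    using that bdd by (simp add: d_def cINF_lower)
  have "\<exists>v\<in>K. q v < d + 1 / real (Suc n)" for n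
    using cInf_lessD[of "q ` K" "d + 1 / real (Suc n)"] K(1) by (auto simp: d_def)
  then obtain z where z: "\<And>n. z n \<in> K" "\<And>n. q (z n) < d + 1 / real (Suc n)" by metis
  have lim: "(\<lambda>n. q (z n)) \<longlonglongrightarrow> d"
  proof (rule tendsto_sandwich[of "\<lambda>n. d" _ _ "\<lambda>n. d + 1 / real (Suc n)"])
    show "(\<lambda>n. d + 1 / real (Suc n)) \<longlonglongrightarrow> d"
      using tendsto_add[OF tendsto_const LIMSEQ_inverse_real_of_nat, of d]
      by (simp add: inverse_eq_divide)
    show "\<forall>\<^sub>F n in sequentially. q (z n) \<le> d + 1 / real (Suc n)"
      using z(2) by (intro always_eventually allI less_imp_le)
  qed (use z(1) dle in auto)
  have "Cauchy z"
  proof (rule Cauchy_of_midpoint_lower_bound[OF uc, of z f d "\<lambda>_. d"])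
    show "d \<le> (norm ((1/2) *\<^sub>R (z n + z m)))\<^sup>2 - 2 * f ((1/2) *\<^sub>R (z n + z m))" for m n
      using dle[OF midpoint_in_convex[OF K(3) z(1) z(1)]] by (simp add: q_def)
  qed (use lim in \<open>simp_all add: q_def\<close>)
  then obtain u where u: "z \<longlonglongrightarrow> u" using Cauchy_convergent convergentD by blast
  have "u \<in> K" using closed_sequentially[OF K(2)] z(1) u by blast
  moreover have "(\<lambda>n. q (z n)) \<longlonglongrightarrow> q u"
    unfolding q_def using u by (intro tendsto_intros)
  then have "q u = d" using lim LIMSEQ_unique by blast
  ultimately show ?thesis using that dle by blast
qed

text \<open>The sequence alternating between \<open>u\<close> and \<open>v\<close> is itself
  minimizing, hence Cauchy, which forces \<open>u = v\<close>.\<close>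

lemma quadratic_minimizer_unique:
  fixes f :: "'a::real_normed_vector \<Rightarrow>\<^sub>L real" and K :: "'a set"
  defines "q \<equiv> \<lambda>u. (norm u)\<^sup>2 - 2 * f u"
  assumes uc: "uniformly_convex_space TYPE('a)" and "convex K"
    and u: "u \<in> K" "\<And>w. w \<in> K \<Longrightarrow> q u \<le> q w"
    and v: "v \<in> K" "q v \<le> q u"
  shows "u = v"
proof -
  define z where "z = (\<lambda>n::nat. if even n then u else v)"
  have qv: "q v = q u" using u v by (simp add: order_antisym)
  have z: "z n \<in> K" "q (z n) = q u" for n using u v qv by (simp_all add: z_def)
  have "Cauchy z"
  proof (rule Cauchy_of_midpoint_lower_bound[OF uc, of z f "q u" "\<lambda>_. q u"])
    show "q u \<le> (norm ((1/2) *\<^sub>R (z n + z m)))\<^sup>2 - 2 * f ((1/2) *\<^sub>R (z n + z m))" for m n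
      using u(2)[OF midpoint_in_convex[OF \<open>convex K\<close> z(1) z(1)]] by (simp add: q_def)
  qed (use z(2) in \<open>simp_all add: q_def\<close>)
  have "dist u v < e" if "e > 0" for e
  proof -
    obtain M where "\<And>m n. m \<ge> M \<Longrightarrow> n \<ge> M \<Longrightarrow> dist (z m) (z n) < e"
      using \<open>Cauchy z\<close> \<open>e > 0\<close> unfolding Cauchy_def by blast
    from this[of "2 * M" "Suc (2 * M)"] show ?thesis by (simp add: z_def)
  qed
  from this[of "dist u v"] show ?thesis by auto
qed

section \<open>The duality map\<close>

text \<open>Smoothness speaks of unit directions only; a general direction is reached by
  substituting \<open>norm y * t\<close> for \<open>t\<close>.\<close>

lemma uniformly_smooth_directional_derivative:
  fixes x y :: "'a::real_normed_vector"
  assumes us: "uniformly_smooth_space TYPE('a)" and x: "norm x = 1"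
  obtains l where "((\<lambda>t. (norm (x + t *\<^sub>R y) - norm x) / t) \<longlongrightarrow> l) (at 0)"
proof (cases "y = 0")
  case True
  then show ?thesis using that[of 0] by simp
next
  case False
  define y' where "y' = y /\<^sub>R norm y"
  obtain D where "uniform_limit (sphere (0::'a) 1 \<times> sphere (0::'a) 1)
      (\<lambda>t (x, y). (norm (x + t *\<^sub>R y) - norm x) / t) D (at (0::real))"
    using us unfolding uniformly_smooth_space_def by blast
  then have "((\<lambda>t. (norm (x + t *\<^sub>R y') - norm x) / t) \<longlongrightarrow> D (x, y')) (at 0)"
    using tendsto_uniform_limitI[of _ _ D "at 0" "(x, y')"] x False by (force simp: y'_def)
  moreover have "filterlim (\<lambda>t. norm y * t) (at 0) (at 0)"
    using False by (auto simp: filterlim_at eventually_at_filter intro!: tendsto_eq_intros)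
  ultimately have "((\<lambda>t. (norm (x + (norm y * t) *\<^sub>R y') - norm x) / (norm y * t)) \<longlongrightarrow> D (x, y')) (at 0)"
    by (rule filterlim_compose)
  then have "((\<lambda>t. norm y * ((norm (x + (norm y * t) *\<^sub>R y') - norm x) / (norm y * t)))
      \<longlongrightarrow> norm y * D (x, y')) (at 0)"
    by (rule tendsto_mult_left)
  moreover have "(norm y * t) *\<^sub>R y' = t *\<^sub>R y" for t
    using False by (simp add: y'_def)
  ultimately show ?thesis using that False by simp
qed

text \<open>The functional is the derivative of the norm at \<open>x\<close>. The triangle
  inequality makes it subadditive, and since the limit is two-sided it is also odd, hence
  additive.\<close>

lemma exists_support_functional:
  fixes x :: "'a::real_normed_vector"
  assumes us: "uniformly_smooth_space TYPE('a)" and x: "norm x = 1"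
  obtains g :: "'a \<Rightarrow>\<^sub>L real" where "g x = 1" "norm g \<le> 1"
    "\<And>y. ((\<lambda>t. (norm (x + t *\<^sub>R y) - norm x) / t) \<longlongrightarrow> g y) (at 0)"
proof -
  define Q where "Q = (\<lambda>y t. (norm (x + t *\<^sub>R y) - norm x) / t)"
  have "\<exists>l. (Q y \<longlongrightarrow> l) (at 0)" for y
    using uniformly_smooth_directional_derivative[OF us x, of y] unfolding Q_def by blast
  then obtain G where G: "\<And>y. (Q y \<longlongrightarrow> G y) (at 0)" by metis
  have scale: "G (c *\<^sub>R y) = c * G y" for c y
  proof (cases "c = 0")
    case True
    have "Q 0 = (\<lambda>t. 0)" by (simp add: Q_def)
    then have "(Q 0 \<longlongrightarrow> 0) (at 0)" by simp
    then have "G 0 = 0" using tendsto_unique[OF at_neq_bot G] by blast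
    then show ?thesis using True by simp
  next
    case False
    then have "filterlim (\<lambda>t. c * t) (at 0) (at 0)"
      by (auto simp: filterlim_at eventually_at_filter intro!: tendsto_eq_intros)
    from tendsto_mult_left[OF filterlim_compose[OF G this]]
    have "((\<lambda>t. c * Q y (c * t)) \<longlongrightarrow> c * G y) (at 0)" .
    moreover have "(\<lambda>t. c * Q y (c * t)) = Q (c *\<^sub>R y)"
      using False by (auto simp: Q_def mult.commute)
    ultimately show ?thesis using tendsto_unique[OF at_neq_bot G] by metis
  qed
  have bound: "\<bar>G y\<bar> \<le> norm y" for y
  proof (rule tendsto_upperbound[OF tendsto_rabs[OF G]])
    show "\<forall>\<^sub>F t in at 0. \<bar>Q y t\<bar> \<le> norm y"
    proof (rule always_eventually, rule allI)
      fix t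
      have "\<bar>norm (x + t *\<^sub>R y) - norm x\<bar> \<le> \<bar>t\<bar> * norm y"
        using norm_triangle_ineq3[of "x + t *\<^sub>R y" x] by simp
      then show "\<bar>Q y t\<bar> \<le> norm y"
        by (cases "t = 0") (auto simp: Q_def field_simps)
    qed
  qed simp
  have sub: "G (y + z) \<le> G y + G z" for y z
  proof -
    have right: "(Q w \<longlongrightarrow> G w) (at_right 0)" for w
      using G[of w] by (simp add: filterlim_at_split)
    have "filterlim (\<lambda>t. 2 * t) (at_right 0) (at_right (0::real))"
      by (auto simp: filterlim_at eventually_at_filter intro!: tendsto_eq_intros)
    then have two: "((\<lambda>t. Q w (2 * t)) \<longlongrightarrow> G w) (at_right 0)" for w
      by (rule filterlim_compose[OF right])
    \<comment> \<open>The step \<open>2 * t\<close> comes from splitting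
      \<open>2 *\<^sub>R (x + t *\<^sub>R (y + z))\<close> into two perturbations of
      \<open>x\<close>; dividing by \<open>2 * t\<close> keeps the inequality only for
      \<open>t > 0\<close>, hence the one-sided limits.\<close>
    have "\<forall>\<^sub>F t in at_right 0. Q (y + z) t \<le> Q y (2 * t) + Q z (2 * t)"
      unfolding eventually_at_filter
    proof (rule always_eventually, intro allI impI)
      fix t :: real assume "t \<noteq> 0" "t \<in> {0<..}"
      then have "t > 0" by simp
      have "2 *\<^sub>R (x + t *\<^sub>R (y + z)) = (x + (2 * t) *\<^sub>R y) + (x + (2 * t) *\<^sub>R z)"
        by (simp add: scaleR_add_right scaleR_2)
      then have "2 * norm (x + t *\<^sub>R (y + z)) \<le> norm (x + (2 * t) *\<^sub>R y) + norm (x + (2 * t) *\<^sub>R z)"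
        by (metis norm_scaleR abs_numeral norm_triangle_ineq)
      then have "(2 * norm (x + t *\<^sub>R (y + z)) - 2 * norm x) / (2 * t)
          \<le> (norm (x + (2 * t) *\<^sub>R y) + norm (x + (2 * t) *\<^sub>R z) - 2 * norm x) / (2 * t)"
        using \<open>t > 0\<close> by (intro divide_right_mono) auto
      then show "Q (y + z) t \<le> Q y (2 * t) + Q z (2 * t)"
        by (simp add: Q_def diff_divide_distrib add_divide_distrib)
    qed
    then show ?thesis
      by (intro tendsto_le[OF _ tendsto_add[OF two two] right]) simp_all
  qed
  \<comment> \<open>Subadditivity at \<open>-y\<close>, \<open>-z\<close> together with oddness is
    the reverse inequality.\<close>
  have add: "G (y + z) = G y + G z" for y z
    using sub[of y z] sub[of "-y" "-z"] scale[of "-1" y] scale[of "-1" z] scale[of "-1" "y + z"]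
    by simp
  have bl: "bounded_linear G"
    by (rule bounded_linear_intro[of _ 1]) (use add scale bound in auto)
  have "(\<lambda>t. 1 + t) \<midarrow>0\<rightarrow> (1::real)" by (auto intro!: tendsto_eq_intros)
  then have "\<forall>\<^sub>F t in at 0. (1 + t) > (0::real)" by (rule order_tendstoD) simp
  moreover have "\<forall>\<^sub>F t in at (0::real). t \<noteq> 0" by (simp add: eventually_at_filter)
  ultimately have "\<forall>\<^sub>F t in at 0. Q x t = 1"
  proof eventually_elim
    case (elim t)
    have "x + t *\<^sub>R x = (1 + t) *\<^sub>R x" by (simp add: scaleR_add_left)
    then show ?case using elim x by (simp add: Q_def)
  qed
  then have "G x = 1" using tendsto_unique[OF at_neq_bot G tendsto_eventually] by blast
  moreover have app: "blinfun_apply (Blinfun G) = G" by (rule bounded_linear_Blinfun_apply[OF bl])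
  moreover have "norm (Blinfun G) \<le> 1"
    by (rule norm_blinfun_bound) (simp_all add: app bound)
  ultimately show ?thesis using that[of "Blinfun G"] G unfolding Q_def by simp
qed

text \<open>A norm-one functional attaining its norm at \<open>x\<close> lies below the difference quotients of the
  norm for \<open>t > 0\<close> and above them for \<open>t < 0\<close>, so it is the derivative.\<close>

lemma support_functional_unique:
  fixes g h :: "'a::real_normed_vector \<Rightarrow>\<^sub>L real"
  assumes x: "norm x = 1" and h: "h x = 1" "norm h \<le> 1"
    and lim: "\<And>y. ((\<lambda>t. (norm (x + t *\<^sub>R y) - norm x) / t) \<longlongrightarrow> g y) (at 0)"
  shows "h = g"
proof (rule blinfun_eqI)
  fix y
  have *: "t * h y \<le> norm (x + t *\<^sub>R y) - norm x" for t
  proof -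
    have "h (x + t *\<^sub>R y) \<le> norm h * norm (x + t *\<^sub>R y)"
      using norm_blinfun[of h "x + t *\<^sub>R y"] by simp
    also have "\<dots> \<le> norm (x + t *\<^sub>R y)" using h(2) by (simp add: mult_left_le_one_le)
    finally show ?thesis using h x by (simp add: blinfun.bilinear_simps)
  qed
  have "h y \<le> g y"
  proof (rule tendsto_lowerbound[OF filterlim_mono[OF lim order_refl at_le]])
    show "\<forall>\<^sub>F t in at_right 0. h y \<le> (norm (x + t *\<^sub>R y) - norm x) / t"
      unfolding eventually_at_filter
      by (rule always_eventually) (use * in \<open>auto simp: field_simps\<close>)
  qed auto
  moreover have "g y \<le> h y"
  proof (rule tendsto_upperbound[OF filterlim_mono[OF lim order_refl at_le]])
    show "\<forall>\<^sub>F t in at_left 0. (norm (x + t *\<^sub>R y) - norm x) / t \<le> h y"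
      unfolding eventually_at_filter
      by (rule always_eventually) (use * in \<open>auto simp: field_simps\<close>)
  qed auto
  ultimately show "h y = g y" by simp
qed

text \<open>For \<open>x \<noteq> 0\<close>, dividing a candidate by \<open>norm x\<close> gives a
  functional of norm one with value one at the unit vector \<open>e\<close>, so it is the derivative
  of the norm there.\<close>

lemma duality_map_ex1:
  fixes x :: "'a::real_normed_vector"
  assumes us: "uniformly_smooth_space TYPE('a)"
  shows "\<exists>!f :: 'a \<Rightarrow>\<^sub>L real. blinfun_apply f x = (norm x)\<^sup>2 \<and> (norm x)\<^sup>2 = (norm f)\<^sup>2"
proof (cases "x = 0")
  case True
  then show ?thesis by (intro ex1I[of _ 0]) auto
next
  case False
  define r where "r = norm x"
  define e where "e = x /\<^sub>R r"
  have r: "r > 0" and e: "norm e = 1" and xe: "x = r *\<^sub>R e"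
    using False by (simp_all add: r_def e_def)
  obtain g :: "'a \<Rightarrow>\<^sub>L real" where g: "g e = 1" "norm g \<le> 1"
    and lim: "\<And>y. ((\<lambda>t. (norm (e + t *\<^sub>R y) - norm e) / t) \<longlongrightarrow> g y) (at 0)"
    by (rule exists_support_functional[OF us e]) blast
  have "norm g \<ge> 1" using norm_blinfun[of g e] g e by simp
  then have ng: "norm g = 1" using g by simp
  show ?thesis
  proof (rule ex1I[of _ "r *\<^sub>R g"])
    show "(r *\<^sub>R g) x = (norm x)\<^sup>2 \<and> (norm x)\<^sup>2 = (norm (r *\<^sub>R g))\<^sup>2"
      using r e g ng by (simp add: xe blinfun.bilinear_simps power2_eq_square)
  next
    fix f :: "'a \<Rightarrow>\<^sub>L real"
    assume f: "f x = (norm x)\<^sup>2 \<and> (norm x)\<^sup>2 = (norm f)\<^sup>2"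
    then have nf: "norm f = r" by (simp add: r_def power2_eq_iff_nonneg)
    have "(1/r) *\<^sub>R f = g"
    proof (rule support_functional_unique[OF e _ _ lim])
      have "r * f e = r * r" using f r e by (simp add: xe blinfun.bilinear_simps power2_eq_square)
      then show "((1/r) *\<^sub>R f) e = 1" using r by (simp add: blinfun.bilinear_simps)
      show "norm ((1/r) *\<^sub>R f) \<le> 1" using r nf by simp
    qed
    then show "f = r *\<^sub>R g" using r by auto
  qed
qed

lemma duality_map_apply_self:
  fixes x :: "'a::real_normed_vector"
  assumes "uniformly_smooth_space TYPE('a)"
  shows "duality_map x x = (norm x)\<^sup>2"
  using theI'[OF duality_map_ex1[OF assms, of x]] by (simp add: duality_map_def)

lemma norm_duality_map:
  fixes x :: "'a::real_normed_vector"
  assumes "uniformly_smooth_space TYPE('a)"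
  shows "norm (duality_map x) = norm x"
  using theI'[OF duality_map_ex1[OF assms, of x]]
  by (simp add: duality_map_def power2_eq_iff_nonneg)

lemma duality_map_eqI:
  fixes x :: "'a::real_normed_vector" and f :: "'a \<Rightarrow>\<^sub>L real"
  assumes "uniformly_smooth_space TYPE('a)" "blinfun_apply f x = (norm x)\<^sup>2" "norm f = norm x"
  shows "duality_map x = f"
  unfolding duality_map_def by (rule the1_equality[OF duality_map_ex1]) (use assms in auto)

lemma duality_map_le:
  fixes x u :: "'a::real_normed_vector"
  assumes "uniformly_smooth_space TYPE('a)"
  shows "\<bar>duality_map x u\<bar> \<le> norm x * norm u"
  using norm_blinfun[of "duality_map x" u] by (simp add: norm_duality_map[OF assms])

text \<open>A preimage of \<open>f\<close> is the minimizer of \<open>\<lambda>u. (norm u)\<^sup>2 - 2 * f u\<close>.\<close>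

lemma surj_duality_map:
  assumes us: "uniformly_smooth_space TYPE('a::banach)" and uc: "uniformly_convex_space TYPE('a)"
  shows "surj (duality_map :: 'a \<Rightarrow> 'a \<Rightarrow>\<^sub>L real)"
proof (unfold surj_def, rule allI)
  fix f :: "'a \<Rightarrow>\<^sub>L real"
  obtain u where u: "\<And>v. (norm u)\<^sup>2 - 2 * f u \<le> (norm v)\<^sup>2 - 2 * f v"
    using exists_quadratic_minimizer[OF uc, of UNIV f] by auto
  have upper: "f h \<le> norm u * norm h" for h
  proof (rule field_le_epsilon)
    fix e :: real assume "e > 0"
    \<comment> \<open>Minimality of \<open>u\<close> against \<open>u + t *\<^sub>R h\<close>,
      divided by \<open>t\<close>, leaves an error \<open>t * (norm h)\<^sup>2\<close>; this
      \<open>t\<close> makes it at most \<open>2 * e\<close>, also when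
      \<open>h = 0\<close>.\<close>
    define t where "t = 2 * e / (1 + (norm h)\<^sup>2)"
    have p: "1 + (norm h)\<^sup>2 > 0" by (simp add: add_pos_nonneg)
    then have t: "t > 0" using \<open>e > 0\<close> by (simp add: t_def)
    have "t * (norm h)\<^sup>2 \<le> t * (1 + (norm h)\<^sup>2)" using t by simp
    also have "\<dots> = 2 * e" using p by (simp add: t_def)
    finally have te: "t * (norm h)\<^sup>2 \<le> 2 * e" .
    have "norm (u + t *\<^sub>R h) \<le> norm u + t * norm h"
      using norm_triangle_ineq[of u "t *\<^sub>R h"] t by simp
    then have "(norm (u + t *\<^sub>R h))\<^sup>2 \<le> (norm u + t * norm h)\<^sup>2" by (simp add: power_mono)
    with u[of "u + t *\<^sub>R h"]
    have "t * (2 * f h) \<le> t * (2 * norm u * norm h + t * (norm h)\<^sup>2)"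
      by (simp add: blinfun.bilinear_simps power2_eq_square algebra_simps)
    then have "2 * f h \<le> 2 * norm u * norm h + t * (norm h)\<^sup>2" using t by simp
    then show "f h \<le> norm u * norm h + e" using te by simp
  qed
  have "norm f \<le> norm u"
    by (rule norm_blinfun_bound) (use upper[of "- _"] upper in \<open>auto simp: abs_le_iff blinfun.bilinear_simps\<close>)
  moreover have fu: "f u = (norm u)\<^sup>2"
  proof (rule antisym)
    show "f u \<le> (norm u)\<^sup>2" using upper[of u] by (simp add: power2_eq_square)
    \<comment> \<open>Here \<open>u\<close> is compared with its contractions
      \<open>(1 - t) *\<^sub>R u\<close>.\<close>
    show "(norm u)\<^sup>2 \<le> f u"
    proof (rule field_le_epsilon)
      fix e :: real assume "e > 0"
      define t where "t = min 1 (2 * e / (1 + (norm u)\<^sup>2))"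
      have p: "1 + (norm u)\<^sup>2 > 0" by (simp add: add_pos_nonneg)
      then have t: "t > 0" "t \<le> 1" using \<open>e > 0\<close> by (simp_all add: t_def)
      have "t * (norm u)\<^sup>2 \<le> (2 * e / (1 + (norm u)\<^sup>2)) * (1 + (norm u)\<^sup>2)"
        using t \<open>e > 0\<close> p by (intro mult_mono) (auto simp: t_def)
      also have "\<dots> = 2 * e" using p by simp
      finally have te: "t * (norm u)\<^sup>2 \<le> 2 * e" .
      have "(norm ((1 - t) *\<^sub>R u))\<^sup>2 = (1 - t)\<^sup>2 * (norm u)\<^sup>2"
        by (simp add: power_mult_distrib)
      with u[of "(1 - t) *\<^sub>R u"]
      have "(norm u)\<^sup>2 - 2 * f u \<le> (1 - t)\<^sup>2 * (norm u)\<^sup>2 - 2 * ((1 - t) * f u)"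
        by (simp add: blinfun.scaleR_right)
      then have "t * (2 * (norm u)\<^sup>2) \<le> t * (2 * f u + t * (norm u)\<^sup>2)"
        by (simp add: power2_eq_square algebra_simps)
      then have "2 * (norm u)\<^sup>2 \<le> 2 * f u + t * (norm u)\<^sup>2" using t by simp
      then show "(norm u)\<^sup>2 \<le> f u + e" using te by simp
    qed
  qed
  have "norm u \<le> norm f"
  proof (cases "u = 0")
    case False
    have "norm u * norm u \<le> norm f * norm u"
      using norm_blinfun[of f u] fu by (simp add: power2_eq_square)
    then show ?thesis using False by simp
  qed simp
  ultimately have "duality_map u = f"
    using duality_map_eqI[OF us fu] by simp
  then show "\<exists>u. f = duality_map u" by blast
qed

section \<open>The Lyapunov functional\<close>

lemma lyapunov_ge_norm_diff:
  fixes u v :: "'a::real_normed_vector"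
  assumes "uniformly_smooth_space TYPE('a)"
  shows "(norm u - norm v)\<^sup>2 \<le> lyapunov u v"
  using duality_map_le[OF assms, of v u]
  by (simp add: lyapunov_def power2_diff mult.commute)

lemma lyapunov_le_norm_add:
  fixes u v :: "'a::real_normed_vector"
  assumes "uniformly_smooth_space TYPE('a)"
  shows "lyapunov u v \<le> (norm u + norm v)\<^sup>2"
  using duality_map_le[OF assms, of v u]
  by (simp add: lyapunov_def power2_sum mult.commute)

text \<open>Evaluating \<open>duality_map v\<close> at \<open>u + v\<close>, twice the midpoint, and
  using \<open>2 * a * b \<le> a\<^sup>2 + b\<^sup>2\<close> shows that
  \<open>duality_map v u\<close> is at most the squared norm of the midpoint.\<close>

lemma lyapunov_ge_midpoint_defect:
  fixes u v :: "'a::real_normed_vector"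
  assumes us: "uniformly_smooth_space TYPE('a)"
  shows "((norm u)\<^sup>2 + (norm v)\<^sup>2) / 2 - (norm ((1/2) *\<^sub>R (u + v)))\<^sup>2 \<le> lyapunov u v / 2"
proof -
  define w where "w = norm ((1/2) *\<^sub>R (u + v))"
  have "duality_map v (u + v) \<le> norm v * (2 * w)"
    using duality_map_le[OF us, of v "u + v"] by (simp add: w_def)
  then have "duality_map v u + (norm v)\<^sup>2 \<le> 2 * norm v * w"
    by (simp add: blinfun.bilinear_simps duality_map_apply_self[OF us])
  moreover have "2 * norm v * w \<le> (norm v)\<^sup>2 + w\<^sup>2"
    using zero_le_power2[of "norm v - w"] by (simp add: power2_diff)
  ultimately show ?thesis unfolding w_def[symmetric] lyapunov_def by argo
qed

text \<open>A bounded \<open>lyapunov\<close> keeps \<open>norm (v n)\<close> close to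
  \<open>norm (u n)\<close>, so \<open>v\<close> is bounded; then the midpoint defect is squeezed to
  0 and uniform convexity applies.\<close>

lemma lyapunov_tendsto_0_imp:
  fixes u v :: "nat \<Rightarrow> 'a::real_normed_vector"
  assumes us: "uniformly_smooth_space TYPE('a)" and uc: "uniformly_convex_space TYPE('a)"
    and u: "u \<longlonglongrightarrow> p" and lim: "(\<lambda>n. lyapunov (u n) (v n)) \<longlonglongrightarrow> 0"
  shows "v \<longlonglongrightarrow> p"
proof -
  obtain A where A: "\<And>n. norm (u n) \<le> A"
    using convergent_imp_Bseq[of u] u convergentI unfolding Bseq_def by metis
  obtain B where B: "\<And>n. norm (lyapunov (u n) (v n)) \<le> B"
    using convergent_imp_Bseq[OF convergentI, OF lim] unfolding Bseq_def by metis
  have bv: "norm (v n) \<le> A + sqrt B" for n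
  proof -
    have "(norm (v n) - norm (u n))\<^sup>2 \<le> B"
      using lyapunov_ge_norm_diff[OF us, of "u n" "v n"] B[of n]
      by (simp add: power2_commute)
    then have "norm (v n) - norm (u n) \<le> sqrt B" by (rule real_le_rsqrt)
    then show ?thesis using A[of n] by simp
  qed
  have "B \<ge> 0" using B[of 0] by (meson norm_ge_zero order_trans)
  then have bu: "norm (u n) \<le> A + sqrt B" for n using A[of n] by (simp add: add_increasing2)
  have "(\<lambda>n. u n - v n) \<longlonglongrightarrow> 0"
  proof (rule tendsto_diff_0_uniformly_convex[OF uc bu bv])
    show "(\<lambda>n. ((norm (u n))\<^sup>2 + (norm (v n))\<^sup>2) / 2 - (norm ((1/2) *\<^sub>R (u n + v n)))\<^sup>2) \<longlonglongrightarrow> 0"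
    proof (rule tendsto_sandwich[of "\<lambda>_. 0" _ _ "\<lambda>n. lyapunov (u n) (v n) / 2"])
      have "0 \<le> ((norm a)\<^sup>2 + (norm b)\<^sup>2) / 2 - (norm ((1/2) *\<^sub>R (a + b)))\<^sup>2" for a b :: 'a
      proof -
        have "(norm (a + b))\<^sup>2 \<le> (norm a + norm b)\<^sup>2"
          by (simp add: norm_triangle_ineq power_mono)
        also have "\<dots> \<le> 2 * ((norm a)\<^sup>2 + (norm b)\<^sup>2)"
          using zero_le_power2[of "norm a - norm b"] by (simp add: power2_sum power2_diff)
        finally show ?thesis by (simp add: power_divide)
      qed
      then show "\<forall>\<^sub>F n in sequentially. 0 \<le>
          ((norm (u n))\<^sup>2 + (norm (v n))\<^sup>2) / 2 - (norm ((1/2) *\<^sub>R (u n + v n)))\<^sup>2" by simp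
    qed (use lyapunov_ge_midpoint_defect[OF us] lim in \<open>auto intro!: tendsto_eq_intros\<close>)
  qed
  from tendsto_diff[OF u this] show ?thesis by simp
qed

text \<open>Written as a difference of squared norms minus \<open>2 * duality_map b (a - b)\<close>,
  both parts vanish in the limit, the latter because
  \<open>norm (duality_map (v n)) = norm (v n)\<close> stays bounded.\<close>

lemma lyapunov_diff_tendsto_0:
  fixes u v :: "nat \<Rightarrow> 'a::real_normed_vector"
  assumes us: "uniformly_smooth_space TYPE('a)" and u: "u \<longlonglongrightarrow> p" and v: "v \<longlonglongrightarrow> p"
  shows "(\<lambda>n. lyapunov (u n) (v n)) \<longlonglongrightarrow> 0"
proof -
  have "(\<lambda>n. norm (v n) * norm (u n - v n)) \<longlonglongrightarrow> norm p * norm (p - p)"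
    using u v by (intro tendsto_intros)
  then have lim: "(\<lambda>n. norm (v n) * norm (u n - v n)) \<longlonglongrightarrow> 0" by simp
  have "(\<lambda>n. duality_map (v n) (u n - v n)) \<longlonglongrightarrow> 0"
    by (rule Lim_null_comparison[OF _ lim]) (simp add: duality_map_le[OF us])
  moreover have "(\<lambda>n. (norm (u n))\<^sup>2 - (norm (v n))\<^sup>2) \<longlonglongrightarrow> (norm p)\<^sup>2 - (norm p)\<^sup>2"
    using u v by (intro tendsto_intros)
  ultimately have "(\<lambda>n. ((norm (u n))\<^sup>2 - (norm (v n))\<^sup>2) - 2 * duality_map (v n) (u n - v n))
      \<longlonglongrightarrow> ((norm p)\<^sup>2 - (norm p)\<^sup>2) - 2 * 0"
    by (intro tendsto_diff[OF _ tendsto_mult[OF tendsto_const]])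
  moreover have "lyapunov a b = ((norm a)\<^sup>2 - (norm b)\<^sup>2) - 2 * duality_map b (a - b)" for a b :: 'a
    by (simp add: lyapunov_def blinfun.bilinear_simps duality_map_apply_self[OF us])
  ultimately show ?thesis by simp
qed

text \<open>The mixed term is linear in the functional \<open>duality_map w\<close>, and
  \<open>norm w\<close> is the norm of that functional, so only convexity of the squared norm is at
  stake.\<close>

lemma lyapunov_convex_combination_le:
  fixes p u v w :: "'a::real_normed_vector"
  assumes us: "uniformly_smooth_space TYPE('a)" and t: "0 \<le> t" "t \<le> 1"
    and w: "duality_map w = t *\<^sub>R duality_map u + (1 - t) *\<^sub>R duality_map v"
  shows "lyapunov p w \<le> t * lyapunov p u + (1 - t) * lyapunov p v"
proof -
  have "norm w \<le> t * norm u + (1 - t) * norm v"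
    using norm_triangle_ineq[of "t *\<^sub>R duality_map u" "(1 - t) *\<^sub>R duality_map v"] t
    by (simp add: w[symmetric] norm_duality_map[OF us])
  then have "(norm w)\<^sup>2 \<le> (t * norm u + (1 - t) * norm v)\<^sup>2" by (simp add: power_mono)
  also have "\<dots> \<le> t * (norm u)\<^sup>2 + (1 - t) * (norm v)\<^sup>2"
  proof -
    have "t * (norm u)\<^sup>2 + (1 - t) * (norm v)\<^sup>2 - (t * norm u + (1 - t) * norm v)\<^sup>2
        = t * (1 - t) * (norm u - norm v)\<^sup>2"
      by (simp add: power2_eq_square algebra_simps)
    also have "\<dots> \<ge> 0" using t by simp
    finally show ?thesis by simp
  qed
  finally show ?thesis
    by (simp add: lyapunov_def w blinfun.bilinear_simps algebra_simps)
qed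

text \<open>Weak information on the functionals \<open>duality_map (y n)\<close> suffices here: no norm continuity of
  the duality map or of its inverse is involved.\<close>

lemma tendsto_of_duality_combination:
  fixes x y z :: "nat \<Rightarrow> 'a::real_normed_vector"
  assumes us: "uniformly_smooth_space TYPE('a)" and uc: "uniformly_convex_space TYPE('a)"
    and x: "x \<longlonglongrightarrow> p" and y: "y \<longlonglongrightarrow> p" and \<alpha>: "\<alpha> \<longlonglongrightarrow> 0"
    and comb: "\<And>n. duality_map (y n) = \<alpha> n *\<^sub>R duality_map (x n) + (1 - \<alpha> n) *\<^sub>R duality_map (z n)"
  shows "z \<longlonglongrightarrow> p"
proof -
  \<comment> \<open>The limits of \<open>g n p\<close> and \<open>norm (g n)\<close> determine that
    of \<open>lyapunov p (z n)\<close>; both are inherited from \<open>duality_map (y n)\<close>,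
    from which \<open>g n\<close> differs by a null sequence.\<close>
  define g where "g n = (1 - \<alpha> n) *\<^sub>R duality_map (z n)" for n
  have g: "g n = duality_map (y n) - \<alpha> n *\<^sub>R duality_map (x n)" for n
    by (simp add: g_def comb)
  have lim: "(\<lambda>n. \<bar>\<alpha> n\<bar> * norm (x n)) \<longlonglongrightarrow> 0"
    using x \<alpha> by (auto intro!: tendsto_eq_intros)
  have ax: "(\<lambda>n. \<alpha> n *\<^sub>R duality_map (x n)) \<longlonglongrightarrow> 0"
    by (rule Lim_null_comparison[OF _ lim]) (simp add: norm_duality_map[OF us])
  have "(\<lambda>n. lyapunov p (y n)) \<longlonglongrightarrow> 0"
    by (rule lyapunov_diff_tendsto_0[OF us tendsto_const y])
  then have "(\<lambda>n. ((norm p)\<^sup>2 + (norm (y n))\<^sup>2 - lyapunov p (y n)) / 2) \<longlonglongrightarrow> ((norm p)\<^sup>2 + (norm p)\<^sup>2 - 0) / 2"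
    using y by (intro tendsto_intros) auto
  then have "(\<lambda>n. duality_map (y n) p) \<longlonglongrightarrow> (norm p)\<^sup>2" by (simp add: lyapunov_def)
  from tendsto_diff[OF this blinfun.tendsto[OF ax tendsto_const[of p]]]
  have gp: "(\<lambda>n. g n p) \<longlonglongrightarrow> (norm p)\<^sup>2" by (simp add: g blinfun.bilinear_simps)
  have "(\<lambda>n. norm (g n) - norm (duality_map (y n))) \<longlonglongrightarrow> 0"
    by (rule Lim_null_comparison[OF always_eventually tendsto_norm_zero[OF ax]])
      (use norm_triangle_ineq3[of "g n" "duality_map (y n)" for n] in \<open>simp add: g\<close>)
  from tendsto_add[OF this tendsto_norm[OF y]]
  have ng: "(\<lambda>n. norm (g n)) \<longlonglongrightarrow> norm p" by (simp add: norm_duality_map[OF us])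
  have a1: "(\<lambda>n. 1 - \<alpha> n) \<longlonglongrightarrow> 1" using \<alpha> by (auto intro!: tendsto_eq_intros)
  \<comment> \<open>For finitely many \<open>n\<close> the factor \<open>1 - \<alpha> n\<close> may
    vanish and \<open>g n\<close> then says nothing about \<open>z n\<close>.\<close>
  then have pos: "\<forall>\<^sub>F n in sequentially. 1 - \<alpha> n > 0" by (rule order_tendstoD) simp
  have "(\<lambda>n. (norm p)\<^sup>2 - 2 * (g n p / (1 - \<alpha> n)) + (norm (g n) / (1 - \<alpha> n))\<^sup>2)
      \<longlonglongrightarrow> (norm p)\<^sup>2 - 2 * ((norm p)\<^sup>2 / 1) + (norm p / 1)\<^sup>2"
    using gp ng a1 by (intro tendsto_intros) auto
  then have "(\<lambda>n. (norm p)\<^sup>2 - 2 * (g n p / (1 - \<alpha> n)) + (norm (g n) / (1 - \<alpha> n))\<^sup>2) \<longlonglongrightarrow> 0" by simp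
  moreover have "\<forall>\<^sub>F n in sequentially.
      (norm p)\<^sup>2 - 2 * (g n p / (1 - \<alpha> n)) + (norm (g n) / (1 - \<alpha> n))\<^sup>2 = lyapunov p (z n)"
    using pos by eventually_elim
      (simp add: g_def lyapunov_def blinfun.bilinear_simps norm_duality_map[OF us])
  ultimately have "(\<lambda>n. lyapunov p (z n)) \<longlonglongrightarrow> 0" by (rule Lim_transform_eventually)
  then show ?thesis by (rule lyapunov_tendsto_0_imp[OF us uc tendsto_const])
qed

section \<open>Projections, sublevel sets and limits of iterates\<close>

lemma is_arg_min_lyapunov_iff:
  "is_arg_min (\<lambda>y. lyapunov y x) (\<lambda>y. y \<in> K) u \<longleftrightarrow>
    u \<in> K \<and> (\<forall>v\<in>K. (norm u)\<^sup>2 - 2 * duality_map x u \<le> (norm v)\<^sup>2 - 2 * duality_map x v)"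
  by (auto simp: is_arg_min_linorder lyapunov_def)

lemma is_arg_min_gen_proj:
  fixes K :: "'a::banach set"
  assumes "uniformly_convex_space TYPE('a)" "K \<noteq> {}" "closed K" "convex K"
  shows "is_arg_min (\<lambda>y. lyapunov y x) (\<lambda>y. y \<in> K) (gen_proj K x)"
proof -
  obtain u where "is_arg_min (\<lambda>y. lyapunov y x) (\<lambda>y. y \<in> K) u"
    unfolding is_arg_min_lyapunov_iff using exists_quadratic_minimizer[OF assms] by metis
  then show ?thesis unfolding gen_proj_def arg_min_on_def arg_min_def by (rule someI)
qed

text \<open>The terms \<open>(norm v)\<^sup>2\<close> cancel, leaving a condition affine in
  \<open>v\<close>; this keeps every \<open>Cs n\<close> closed and convex.\<close>

lemma lyapunov_sublevel_halfspace:
  "lyapunov v a \<le> lyapunov v b + c \<longleftrightarrow>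
    (duality_map b - duality_map a) v \<le> ((norm b)\<^sup>2 - (norm a)\<^sup>2 + c) / 2"
  by (auto simp: lyapunov_def blinfun.bilinear_simps field_simps)

lemma closed_convex_lyapunov_sublevel:
  assumes "closed K" "convex K"
  shows "closed {v \<in> K. lyapunov v a \<le> lyapunov v b + c}" (is "closed ?S")
    and "convex {v \<in> K. lyapunov v a \<le> lyapunov v b + c}"
proof -
  define g where "g = duality_map b - duality_map a"
  define r where "r = ((norm b)\<^sup>2 - (norm a)\<^sup>2 + c) / 2"
  have S: "?S = K \<inter> {v. g v \<le> r}"
    by (auto simp: lyapunov_sublevel_halfspace g_def r_def)
  have "closed {v. g v \<le> r}" by (intro closed_Collect_le continuous_intros)
  then show "closed ?S" using assms S by auto
  have "convex (g -` {..r})"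
    by (rule convex_linear_vimage) (simp_all add: blinfun.bounded_linear_right bounded_linear.linear)
  then have "convex {v. g v \<le> r}" by (simp add: vimage_def)
  then show "convex ?S" using assms S by (auto intro: convex_Int)
qed

text \<open>As \<open>L\<close> does not depend on \<open>n\<close>, \<open>(T ^^ n) p\<close> has
  the same limit \<open>p\<close> as \<open>(T ^^ n) (x n)\<close>. Applying \<open>T\<close>, which
  is Lipschitz on \<open>C\<close>, gives the shifted sequence the limit \<open>T p\<close>.\<close>

lemma fixed_point_of_iterates:
  fixes T :: "'a::real_normed_vector \<Rightarrow> 'a"
  assumes T: "T \<in> C \<rightarrow> C" and lip: "uniformly_lipschitz_on L C T"
    and x: "\<And>n. x n \<in> C" "x \<longlonglongrightarrow> p" and p: "p \<in> C"
    and Tx: "(\<lambda>n. (T ^^ n) (x n)) \<longlonglongrightarrow> p"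
  shows "T p = p"
proof -
  have inC: "(T ^^ n) p \<in> C" for n by (induction n) (use T p in auto)
  have L: "\<And>n u v. n \<ge> 1 \<Longrightarrow> u \<in> C \<Longrightarrow> v \<in> C \<Longrightarrow> norm ((T ^^ n) u - (T ^^ n) v) \<le> L * norm (u - v)"
    using lip unfolding uniformly_lipschitz_on_def by blast
  have "(\<lambda>n. L * norm (x n - p)) \<longlonglongrightarrow> L * norm (p - p)" using x by (intro tendsto_intros)
  then have lim: "(\<lambda>n. L * norm (x n - p)) \<longlonglongrightarrow> 0" by simp
  have "(\<lambda>n. (T ^^ n) (x n) - (T ^^ n) p) \<longlonglongrightarrow> 0"
    by (rule Lim_null_comparison[OF eventually_sequentiallyI lim]) (rule L[OF _ x(1) p])
  from tendsto_diff[OF Tx this] have Tp: "(\<lambda>n. (T ^^ n) p) \<longlonglongrightarrow> p" by simp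
  have "(\<lambda>n. L * norm ((T ^^ n) p - p)) \<longlonglongrightarrow> L * norm (p - p)" using Tp by (intro tendsto_intros)
  then have lim: "(\<lambda>n. L * norm ((T ^^ n) p - p)) \<longlonglongrightarrow> 0" by simp
  have "(\<lambda>n. T ((T ^^ n) p) - T p) \<longlonglongrightarrow> 0"
    by (rule Lim_null_comparison[OF _ lim]) (use L[of 1, OF _ inC p] in simp)
  then have "(\<lambda>n. (T ^^ Suc n) p) \<longlonglongrightarrow> T p" by (simp add: LIM_zero_iff)
  then show ?thesis using LIMSEQ_Suc[OF Tp] LIMSEQ_unique by blast
qed


section \<open>Strong convergence of the projection scheme\<close>

theorem theorem1:
  fixes C :: "'a::banach set" and N :: nat and T :: "nat \<Rightarrow> 'a \<Rightarrow> 'a"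
    and k \<alpha> \<epsilon> L :: "nat \<Rightarrow> real" and \<omega> :: real and F :: "'a set"
    and x :: "nat \<Rightarrow> 'a" and y :: "nat \<Rightarrow> nat \<Rightarrow> 'a" and i :: "nat \<Rightarrow> nat"
    and ybar :: "nat \<Rightarrow> 'a" and Cs :: "nat \<Rightarrow> 'a set"
  assumes "uniformly_smooth_space TYPE('a)" and "uniformly_convex_space TYPE('a)"
    and "C \<noteq> {}" and "closed C" and "convex C"
    and "N \<ge> 1"
    and "\<And>j. j \<in> {1..N} \<Longrightarrow> T j \<in> C \<rightarrow> C"
    and "\<And>n. 1 \<le> k n" and "k \<longlonglongrightarrow> 1"
    and "\<And>j. j \<in> {1..N} \<Longrightarrow> asymp_quasi_phi_nonexpansive C (T j) k"
    and "\<And>j. j \<in> {1..N} \<Longrightarrow> uniformly_lipschitz_on (L j) C (T j)"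
    and "F = (\<Inter>j\<in>{1..N}. fixed_points_on C (T j))"
    and "F \<noteq> {}"
    and "\<omega> > 0" and "F \<subseteq> {u \<in> C. norm u \<le> \<omega>}"
    and "\<And>n. \<alpha> n \<in> {0..1}" and "\<alpha> \<longlonglongrightarrow> 0"
    and "\<And>n. \<epsilon> n = (k n - 1) * (\<omega> + norm (x n))\<^sup>2"
    and "x 0 \<in> C" and "Cs 0 = C"
    and "\<And>n j. j \<in> {1..N} \<Longrightarrow>
      y n j = inv duality_map
        (\<alpha> n *\<^sub>R duality_map (x n) + (1 - \<alpha> n) *\<^sub>R duality_map ((T j ^^ n) (x n)))"
    and "\<And>n. is_arg_max (\<lambda>j. norm (y n j - x n)) (\<lambda>j. j \<in> {1..N}) (i n)"
    and "\<And>n. ybar n = y n (i n)"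
    and "\<And>n. Cs (Suc n) = {v \<in> Cs n. lyapunov v (ybar n) \<le> lyapunov v (x n) + \<epsilon> n}"
    and "\<And>n. x (Suc n) = gen_proj (Cs (Suc n)) (x 0)"
  shows "x \<longlonglongrightarrow> gen_proj F (x 0)"
proof -
  note us = assms(1) and uc = assms(2)
  let ?J = "duality_map :: 'a \<Rightarrow> 'a \<Rightarrow>\<^sub>L real"
  have y: "?J (y n j) = \<alpha> n *\<^sub>R ?J (x n) + (1 - \<alpha> n) *\<^sub>R ?J ((T j ^^ n) (x n))"
    if "j \<in> {1..N}" for n j
    unfolding assms(21)[OF that] by (rule surj_f_inv_f[OF surj_duality_map[OF us uc]])
  have i: "i n \<in> {1..N}" for n
    using assms(22)[of n] by (simp add: is_arg_max_def)
  \<comment> \<open>This is what lets \<open>F\<close> survive each cut from \<open>Cs n\<close> to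
    \<open>Cs (Suc n)\<close>.\<close>
  have F_step: "lyapunov p (ybar n) \<le> lyapunov p (x n) + \<epsilon> n" if "p \<in> F" "x n \<in> C" for p n
  proof -
    have a: "0 \<le> \<alpha> n" "\<alpha> n \<le> 1" using assms(16)[of n] by auto
    have p: "p \<in> fixed_points_on C (T (i n))" using that(1) i[of n] assms(12) by blast
    have l0: "0 \<le> lyapunov p (x n)"
      using lyapunov_ge_norm_diff[OF us, of p "x n"] by (meson order_trans zero_le_power2)
    have "lyapunov p ((T (i n) ^^ n) (x n)) \<le> k n * lyapunov p (x n)"
    \<comment> \<open>The hypothesis on \<open>T\<close> covers only \<open>n \<ge> 1\<close>; at 0
      the iterate is the identity and \<open>1 \<le> k 0\<close> is enough.\<close>
    proof (cases "n = 0")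
      case True
      then show ?thesis using mult_right_mono[OF assms(8)[of n] l0] by simp
    next
      case False
      then show ?thesis using assms(10)[OF i[of n]] p that(2)
        by (simp add: asymp_quasi_phi_nonexpansive_def)
    qed
    then have "lyapunov p (ybar n) \<le> \<alpha> n * lyapunov p (x n) + (1 - \<alpha> n) * (k n * lyapunov p (x n))"
      using lyapunov_convex_combination_le[OF us a y[OF i[of n]], of p] a assms(23)[of n]
        mult_left_mono[of "lyapunov p ((T (i n) ^^ n) (x n))" _ "1 - \<alpha> n"] by force
    also have "\<dots> = lyapunov p (x n) + (1 - \<alpha> n) * ((k n - 1) * lyapunov p (x n))"
      by (simp add: algebra_simps)
    also have "\<dots> \<le> lyapunov p (x n) + (k n - 1) * lyapunov p (x n)"
      using a assms(8)[of n] l0 by (simp add: mult_left_le_one_le)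
    \<comment> \<open>The bound \<open>\<omega>\<close> on \<open>F\<close> makes the estimate
      uniform in \<open>p\<close>; this explains the form of \<open>\<epsilon> n\<close>.\<close>
    also have "lyapunov p (x n) \<le> (\<omega> + norm (x n))\<^sup>2"
      using lyapunov_le_norm_add[OF us, of p "x n"] assms(15) that(1)
        power_mono[of "norm p + norm (x n)" "\<omega> + norm (x n)" 2] by force
    then have "lyapunov p (x n) + (k n - 1) * lyapunov p (x n) \<le> lyapunov p (x n) + \<epsilon> n"
      using assms(8)[of n] by (simp add: assms(18) mult_left_mono)
    finally show ?thesis .
  qed
  \<comment> \<open>The claims go through the induction together:
    \<open>F \<subseteq> Cs (Suc n)\<close> uses \<open>x n \<in> C\<close> and makes
    \<open>Cs (Suc n)\<close> nonempty, which the projection \<open>x (Suc n)\<close>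
    requires.\<close>
  have inv: "closed (Cs n) \<and> convex (Cs n) \<and> F \<subseteq> Cs n \<and> Cs n \<subseteq> C \<and>
      is_arg_min (\<lambda>v. lyapunov v (x 0)) (\<lambda>v. v \<in> Cs n) (x n)" for n
  proof (induction n)
    case 0
    \<comment> \<open>The starting point is not given as a projection, but it minimizes because
      \<open>lyapunov\<close> is nonnegative.\<close>
    have "lyapunov (x 0) (x 0) = 0"
      by (simp add: lyapunov_def duality_map_apply_self[OF us])
    moreover have "0 \<le> lyapunov v (x 0)" for v
      using lyapunov_ge_norm_diff[OF us, of v "x 0"] by (meson order_trans zero_le_power2)
    ultimately show ?case
      using assms(4,5,15,19,20) by (auto simp: is_arg_min_linorder)
  next
    case (Suc n)
    then have xC: "x n \<in> C" by (auto simp: is_arg_min_def)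
    have F: "F \<subseteq> Cs (Suc n)" using Suc F_step[OF _ xC] by (auto simp: assms(24))
    have "closed (Cs (Suc n))" "convex (Cs (Suc n))"
      unfolding assms(24)[of n] using Suc by (intro closed_convex_lyapunov_sublevel; blast)+
    moreover from this have "is_arg_min (\<lambda>v. lyapunov v (x 0)) (\<lambda>v. v \<in> Cs (Suc n)) (x (Suc n))"
      using is_arg_min_gen_proj[OF uc] F assms(13) by (auto simp: assms(25))
    ultimately show ?case using Suc F by (auto simp: assms(24))
  qed
  have xCs: "x n \<in> Cs n" for n using inv[of n] by (simp add: is_arg_min_def)
  have anti: "Cs m \<subseteq> Cs n" if "n \<le> m" for n m
    by (rule lift_Suc_antimono_le[OF _ that]) (auto simp: assms(24))
  have xC: "x n \<in> C" for n using xCs inv by blast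
  \<comment> \<open>This is \<open>lyapunov u (x 0)\<close> without its constant term.\<close>
  define q where "q u = (norm u)\<^sup>2 - 2 * ?J (x 0) u" for u
  have min: "q (x n) \<le> q v" if "v \<in> Cs n" for n v
    using inv[of n] that by (simp add: is_arg_min_lyapunov_iff q_def)
  obtain p0 where p0: "p0 \<in> F" using assms(13) by blast
  have "incseq (\<lambda>n. q (x n))"
    by (rule incseq_SucI) (use min xCs anti[OF le_SucI[OF order_refl]] in blast)
  moreover have "q (x n) \<le> q p0" for n using min inv p0 by blast
  ultimately obtain d where d: "(\<lambda>n. q (x n)) \<longlonglongrightarrow> d"
    using incseq_convergent by blast
  \<comment> \<open>For \<open>n \<le> m\<close> both \<open>x n\<close> and \<open>x m\<close> lie
    in the convex set \<open>Cs n\<close>, so \<open>q (x n)\<close> bounds \<open>q\<close> at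
    their midpoint from below.\<close>
  have "Cauchy x"
  proof (rule Cauchy_of_midpoint_lower_bound[OF uc, of x "?J (x 0)" d "\<lambda>n. q (x n)"])
    show "q (x n) \<le> (norm ((1/2) *\<^sub>R (x n + x m)))\<^sup>2 - 2 * ?J (x 0) ((1/2) *\<^sub>R (x n + x m))"
      if "n \<le> m" for m n
      using min[OF midpoint_in_convex[of "Cs n" "x n" "x m"]] inv[of n] xCs[of n] xCs[of m] anti[OF that]
      unfolding q_def by blast
  qed (use d in \<open>simp_all add: q_def\<close>)
  then obtain p where p: "x \<longlonglongrightarrow> p" using Cauchy_convergent convergentD by blast
  have pC: "p \<in> C" using closed_sequentially[OF assms(4)] xC p by blast
  have pCs: "p \<in> Cs n" for n
  proof (rule closed_sequentially[of "Cs n" "\<lambda>m. x (m + n)"])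
    show "x (m + n) \<in> Cs n" for m using xCs anti[of n "m + n"] by auto
  qed (use inv LIMSEQ_ignore_initial_segment[OF p] in auto)
  have "(\<lambda>n. (k n - 1) * (\<omega> + norm (x n))\<^sup>2) \<longlonglongrightarrow> (1 - 1) * (\<omega> + norm p)\<^sup>2"
    using p assms(9) by (intro tendsto_intros)
  then have eps: "\<epsilon> \<longlonglongrightarrow> 0" by (simp add: assms(18)[abs_def])
  have xS: "(\<lambda>n. x (Suc n)) \<longlonglongrightarrow> p" by (rule LIMSEQ_Suc[OF p])
  have "(\<lambda>n. lyapunov (x (Suc n)) (ybar n)) \<longlonglongrightarrow> 0"
  proof (rule tendsto_sandwich[of "\<lambda>_. 0" _ _ "\<lambda>n. lyapunov (x (Suc n)) (x n) + \<epsilon> n"])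
    show "\<forall>\<^sub>F n in sequentially. 0 \<le> lyapunov (x (Suc n)) (ybar n)"
      using lyapunov_ge_norm_diff[OF us] by (meson always_eventually order_trans zero_le_power2)
    show "\<forall>\<^sub>F n in sequentially. lyapunov (x (Suc n)) (ybar n) \<le> lyapunov (x (Suc n)) (x n) + \<epsilon> n"
      using xCs[of "Suc _"] by (auto simp: assms(24))
    show "(\<lambda>n. lyapunov (x (Suc n)) (x n) + \<epsilon> n) \<longlonglongrightarrow> 0"
      using tendsto_add[OF lyapunov_diff_tendsto_0[OF us xS p] eps] by simp
  qed simp
  from lyapunov_tendsto_0_imp[OF us uc xS this] have "ybar \<longlonglongrightarrow> p" .
  from tendsto_norm_zero[OF LIM_zero[OF tendsto_diff[OF this p]]]
  have yx: "(\<lambda>n. norm (ybar n - x n)) \<longlonglongrightarrow> 0" by simp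
  have "T j p = p" if j: "j \<in> {1..N}" for j
  proof -
    \<comment> \<open>The index \<open>i n\<close> picks the largest deviation, so controlling
      \<open>ybar\<close> controls all \<open>N\<close> sequences.\<close>
    have "norm (y n j - x n) \<le> norm (ybar n - x n)" for n
      using assms(22)[of n] j by (auto simp: is_arg_max_linorder assms(23))
    then have "(\<lambda>n. y n j - x n) \<longlonglongrightarrow> 0"
      by (intro Lim_null_comparison[OF always_eventually yx] allI)
    from tendsto_add[OF this p] have "(\<lambda>n. y n j) \<longlonglongrightarrow> p" by simp
    from tendsto_of_duality_combination[OF us uc p this assms(17) y[OF j]]
    have "(\<lambda>n. (T j ^^ n) (x n)) \<longlonglongrightarrow> p" .
    then show ?thesis
      using fixed_point_of_iterates[OF assms(7)[OF j] assms(11)[OF j] xC p pC] by blast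
  qed
  then have pF: "p \<in> F" using pC by (auto simp: assms(12) fixed_points_on_def)
  have "(\<lambda>n. q (x n)) \<longlonglongrightarrow> q p" unfolding q_def using p by (intro tendsto_intros)
  then have min_p: "q p \<le> q v" if "v \<in> (\<Inter>n. Cs n)" for v
    by (rule LIMSEQ_le_const2) (use min that in blast)
  have "F \<subseteq> (\<Inter>n. Cs n)" using inv by blast
  then have "is_arg_min (\<lambda>v. lyapunov v (x 0)) (\<lambda>v. v \<in> F) p"
    using min_p pF by (auto simp: is_arg_min_lyapunov_iff q_def)
  \<comment> \<open>\<open>gen_proj\<close> chooses some minimizer, so the existence of the
    minimizer \<open>p\<close> makes it one too.\<close>
  then have proj: "is_arg_min (\<lambda>v. lyapunov v (x 0)) (\<lambda>v. v \<in> F) (gen_proj F (x 0))"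
    unfolding gen_proj_def arg_min_on_def arg_min_def by (rule someI)
  \<comment> \<open>Uniqueness comes from convexity of the intersection of the \<open>Cs n\<close>, so convexity of \<open>F\<close>
    is never established.\<close>
  have "p = gen_proj F (x 0)"
  proof (rule quadratic_minimizer_unique[OF uc, of "\<Inter>n. Cs n" p "?J (x 0)"])
    show "convex (\<Inter>n. Cs n)" using inv by (intro convex_INT) blast
    show "gen_proj F (x 0) \<in> (\<Inter>n. Cs n)"
      using proj \<open>F \<subseteq> (\<Inter>n. Cs n)\<close> by (auto simp: is_arg_min_def)
  qed (use proj pF pCs min_p in \<open>auto simp: is_arg_min_lyapunov_iff q_def\<close>)
  then show ?thesis using p by simp
qed

end
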